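(* Let $G$ be a topological Abelian semigroup with unit and let $E$ be a Banach space over $\mathbb{C}$. Consider the following properties that a continuous function $f\colon G\to E$ may have: (i) $f$ is a polynomial; (ii) $f$ is a w-polynomial; (iii) $f$ is a generalized polynomial; (iv) $f$ is a local polynomial. Then (i) $\Longrightarrow$ (ii) $\Longrightarrow$ (iii) $\Longrightarrow$ (iv).
   Context: The semigroup operation is written additively, with unit $0$. For a function $f$ on $G$ with values in a complex vector space and $g\in G$, put $T_g f(x)=f(x+g)$ and $\Delta_g f(x)=f(x+g)-f(x)$; $L_f$ denotes the complex linear span of $\{T_g f: g\in G\}$. $E^*$ is the space of continuous linear functionals on $E$. A continuous function $f\colon G\to E$ is a generalized polynomial if there is an $n\ge 0$ such that $\Delta_{h_1}\cdots\Delta_{h_{n+1}}f=0$ for every $h_1,\ldots,h_{n+1}\in G$. It is a polynomial if it is a generalized polynomial and $\dim L_f<\infty$. A complex valued function $f\colon G\to\mathbb{C}$ is a (complex valued) polynomial if there are continuous additive functions $a_1,\ldots,a_n\colon G\to\mathbb{C}$ and $P\in\mathbb{C}[x_1,\ldots,x_n]$ such that $f=P(a_1,\ldots,a_n)$. A continuous function $f\colon G\to E$ is a w-polynomial if $u\circ f$ is a complex valued polynomial for every $u\in E^*$. A continuous function $f\colon G\to E$ is a local polynomial if the restriction of $f$ to any finitely generated subsemigroup of $G$ is a polynomial (on that subsemigroup). *)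

theory Defs
  imports
    "HOL-Analysis.Analysis"
    "HOL-Library.Function_Algebras"
    "HOL-Library.Poly_Mapping"
begin

text \<open>
  Complex Banach spaces: the real Banach space classes of the library, extended by a compatible
  complex scalar multiplication.
\<close>

class complex_normed_vector = real_normed_vector +
  fixes scaleC :: "complex \<Rightarrow> 'a \<Rightarrow> 'a" (infixr "*\<^sub>C" 75)
  assumes scaleC_add_right: "c *\<^sub>C (x + y) = c *\<^sub>C x + c *\<^sub>C y"
    and scaleC_add_left: "(c + d) *\<^sub>C x = c *\<^sub>C x + d *\<^sub>C x"
    and scaleC_scaleC: "c *\<^sub>C d *\<^sub>C x = (c * d) *\<^sub>C x"
    and scaleC_one: "1 *\<^sub>C x = x"
    and scaleC_of_real: "complex_of_real r *\<^sub>C x = r *\<^sub>R x"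
    and norm_scaleC: "norm (c *\<^sub>C x) = cmod c * norm x"

class complex_banach = complex_normed_vector + banach

instantiation complex :: complex_banach
begin

definition scaleC_complex :: "complex \<Rightarrow> complex \<Rightarrow> complex"
  where "scaleC_complex c z = c * z"

instance
  by standard (auto simp: scaleC_complex_def algebra_simps norm_mult scaleR_conv_of_real)

end

interpretation complex_vector: vector_space "scaleC :: complex \<Rightarrow> 'e::complex_normed_vector \<Rightarrow> 'e"
  by standard (simp_all add: scaleC_add_right scaleC_add_left scaleC_scaleC scaleC_one)

definition fun_scaleC :: "complex \<Rightarrow> ('g \<Rightarrow> 'e) \<Rightarrow> 'g \<Rightarrow> 'e::complex_normed_vector"
  where "fun_scaleC c f = (\<lambda>x. c *\<^sub>C f x)"

interpretation complex_fun: vector_space "fun_scaleC :: complex \<Rightarrow> ('g \<Rightarrow> 'e::complex_normed_vector) \<Rightarrow> 'g \<Rightarrow> 'e"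
  by standard
    (auto simp: fun_scaleC_def fun_eq_iff scaleC_add_right scaleC_add_left scaleC_scaleC scaleC_one)

text \<open>
  The notions below are relative to a subsemigroup \<open>S\<close> of the ambient semigroup, with the
  subspace topology. The whole semigroup is the case \<open>S = UNIV\<close>.
\<close>

definition translate :: "'g \<Rightarrow> ('g \<Rightarrow> 'e) \<Rightarrow> 'g::plus \<Rightarrow> 'e"
  where "translate g f = (\<lambda>x. f (x + g))"

definition difference :: "'g \<Rightarrow> ('g \<Rightarrow> 'e) \<Rightarrow> 'g::plus \<Rightarrow> 'e::minus"
  where "difference g f = (\<lambda>x. f (x + g) - f x)"

text \<open>
  Functions on \<open>S\<close> are represented by their extensions by zero; this identifies the complex vector
  space of functions on \<open>S\<close> with a subspace of the functions on the whole type.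
\<close>

definition restrict_zero :: "'g set \<Rightarrow> ('g \<Rightarrow> 'e) \<Rightarrow> 'g \<Rightarrow> 'e::zero"
  where "restrict_zero S f = (\<lambda>x. if x \<in> S then f x else 0)"

definition translates_span_on :: "'g::plus set \<Rightarrow> ('g \<Rightarrow> 'e::complex_normed_vector) \<Rightarrow> ('g \<Rightarrow> 'e) set"
  where "translates_span_on S f = complex_fun.span ((\<lambda>g. restrict_zero S (translate g f)) ` S)"

text \<open>
  Finite-dimensionality is stated by a finite spanning set, since the library's \<open>dim\<close> is \<open>0\<close> on
  infinite-dimensional spaces.
\<close>

definition finite_dimensional :: "('g \<Rightarrow> 'e::complex_normed_vector) set \<Rightarrow> bool"
  where "finite_dimensional V \<longleftrightarrow> (\<exists>B. finite B \<and> complex_fun.span B = V)"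

text \<open>With \<open>hs = [h\<^sub>1, \<dots>, h\<^sub>k]\<close>, the fold below is \<open>\<Delta>\<^bsub>h\<^sub>1\<^esub> \<dots> \<Delta>\<^bsub>h\<^sub>k\<^esub> f\<close>.\<close>

definition is_generalized_polynomial_on ::
    "'g::{topological_space, plus} set \<Rightarrow> ('g \<Rightarrow> 'e::complex_normed_vector) \<Rightarrow> bool"
  where "is_generalized_polynomial_on S f \<longleftrightarrow>
    continuous_on S f \<and>
    (\<exists>n::nat. \<forall>hs. length hs = n + 1 \<and> set hs \<subseteq> S \<longrightarrow> (\<forall>x\<in>S. foldr difference hs f x = 0))"

definition is_polynomial_on ::
    "'g::{topological_space, plus} set \<Rightarrow> ('g \<Rightarrow> 'e::complex_normed_vector) \<Rightarrow> bool"
  where "is_polynomial_on S f \<longleftrightarrow>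
    is_generalized_polynomial_on S f \<and> finite_dimensional (translates_span_on S f)"

abbreviation is_generalized_polynomial ::
    "('g::{topological_space, plus} \<Rightarrow> 'e::complex_normed_vector) \<Rightarrow> bool"
  where "is_generalized_polynomial \<equiv> is_generalized_polynomial_on UNIV"

abbreviation is_polynomial ::
    "('g::{topological_space, plus} \<Rightarrow> 'e::complex_normed_vector) \<Rightarrow> bool"
  where "is_polynomial \<equiv> is_polynomial_on UNIV"

text \<open>
  A polynomial in \<open>\<complex>[x\<^sub>0, \<dots>, x\<^bsub>n-1\<^esub>]\<close> is a finitely supported map from monomials to coefficients,
  a monomial being a finitely supported map from variable indices \<open>i < n\<close> to exponents.
\<close>

type_synonym complex_mpoly = "(nat \<Rightarrow>\<^sub>0 nat) \<Rightarrow>\<^sub>0 complex"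

definition in_variables :: "nat \<Rightarrow> complex_mpoly \<Rightarrow> bool"
  where "in_variables n P \<longleftrightarrow> (\<forall>m \<in> Poly_Mapping.keys P. Poly_Mapping.keys m \<subseteq> {..<n})"

definition eval_mpoly :: "complex_mpoly \<Rightarrow> (nat \<Rightarrow> complex) \<Rightarrow> complex"
  where "eval_mpoly P z =
    (\<Sum>m \<in> Poly_Mapping.keys P.
      Poly_Mapping.lookup P m * (\<Prod>i \<in> Poly_Mapping.keys m. z i ^ Poly_Mapping.lookup m i))"

definition continuous_additive :: "('g::{topological_space, plus} \<Rightarrow> complex) \<Rightarrow> bool"
  where "continuous_additive a \<longleftrightarrow> continuous_on UNIV a \<and> (\<forall>x y. a (x + y) = a x + a y)"

definition is_complex_polynomial :: "('g::{topological_space, plus} \<Rightarrow> complex) \<Rightarrow> bool"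
  where "is_complex_polynomial f \<longleftrightarrow>
    (\<exists>n a P. (\<forall>i<n. continuous_additive (a i)) \<and> in_variables n P \<and>
      (\<forall>x. f x = eval_mpoly P (\<lambda>i. a i x)))"

definition dual_space :: "('e::complex_normed_vector \<Rightarrow> complex) set"
  where "dual_space = {u. Vector_Spaces.linear (*\<^sub>C) (*) u \<and> continuous_on UNIV u}"

definition is_w_polynomial ::
    "('g::{topological_space, plus} \<Rightarrow> 'e::complex_normed_vector) \<Rightarrow> bool"
  where "is_w_polynomial f \<longleftrightarrow>
    continuous_on UNIV f \<and> (\<forall>u \<in> dual_space. is_complex_polynomial (u \<circ> f))"

definition subsemigroup_generated :: "'g::plus set \<Rightarrow> 'g set"
  where "subsemigroup_generated A = (\<lambda>S. \<forall>x\<in>S. \<forall>y\<in>S. x + y \<in> S) hull A"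

text \<open>
  The generated subsemigroups need not contain the unit of the ambient semigroup; those that do
  arise from the finite sets \<open>A\<close> with \<open>0 \<in> A\<close>, among others.
\<close>

definition is_local_polynomial ::
    "('g::{topological_space, plus} \<Rightarrow> 'e::complex_normed_vector) \<Rightarrow> bool"
  where "is_local_polynomial f \<longleftrightarrow>
    continuous_on UNIV f \<and>
    (\<forall>A. finite A \<longrightarrow> is_polynomial_on (subsemigroup_generated A) f)"

end

theory Submission
  imports Defs
begin

text \<open>
  A function is a generalized polynomial of degree below \<open>n\<close> when all its \<open>n\<close>-fold differences vanish
  (\<open>degree_below n f\<close>). Each implication rests on its own idea.

  \<^emph>\<open>Polynomials are w-polynomials.\<close> Composing with a functional reduces the claim to a complex valued
  \<open>f\<close> in a finite-dimensional translation-invariant space \<open>V\<close> of continuous functions, and one argues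
  by induction on the degree. Let \<open>f\<close> have degree at most \<open>n\<close>. Modulo functions of degree at most
  \<open>n - 2\<close>, the difference \<open>\<Delta>\<^sub>h f\<close> is additive in \<open>h\<close>, because
  \<open>\<Delta>\<^bsub>g+h\<^esub> f = \<Delta>\<^sub>g f + \<Delta>\<^sub>h f + \<Delta>\<^sub>h \<Delta>\<^sub>g f\<close>. Taking coordinates in \<open>V\<close> gives
  \<open>\<Delta>\<^sub>h f \<equiv> \<Sum>\<^sub>i a\<^sub>i(h) b\<^sub>i\<close> with \<open>a\<^sub>i\<close> additive and continuous and \<open>b\<^sub>i \<in> V\<close> of degree at most \<open>n - 1\<close>
  (\<open>leading_part_of_differences\<close>). A discrete form of Euler's identity for homogeneous functions then
  says that \<open>\<Sum>\<^sub>i a\<^sub>i b\<^sub>i - n f\<close> has degree at most \<open>n - 1\<close> (\<open>euler_identity_mod_lower_degree\<close>). The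
  \<open>b\<^sub>i\<close> and this remainder, which lies in a slightly larger finite-dimensional invariant space, are
  complex polynomials by induction, hence so is \<open>f\<close>.

  \<^emph>\<open>W-polynomials are generalized polynomials.\<close> Every continuous real-linear functional \<open>r\<close> is the
  real part of a complex one, and complex polynomials have finite degree, so \<open>r\<close> annihilates all \<open>n\<close>-fold differences of \<open>f\<close> for some \<open>n\<close>
  depending on \<open>r\<close>. The functionals which work for a given \<open>n\<close> form a closed subspace of the real
  dual, and by Baire's theorem one of these countably many subspaces is the whole dual. Since
  functionals separate points (Hahn-Banach), the \<open>n\<close>-fold differences of \<open>f\<close> vanish for that \<open>n\<close>.

  \<^emph>\<open>Generalized polynomials are local polynomials.\<close> If \<open>A\<close> is finite, the iterated differences of \<open>f\<close>
  with steps in \<open>A\<close> are finitely many functions up to the order at which they vanish. Since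
  \<open>T\<^sub>a = 1 + \<Delta>\<^sub>a\<close>, their span is invariant under translation by the elements of \<open>A\<close>, hence by those
  of the generated subsemigroup, and so it contains the relevant translates of \<open>f\<close>.
\<close>

section \<open>Functions of bounded degree\<close>

text \<open>
  The bound on the degree is strict so that the zero function alone has degree below \<open>0\<close>. The recursion
  takes the innermost difference first, which suits inductions where \<open>f\<close> is replaced by \<open>\<Delta>\<^sub>h f\<close>.
\<close>

primrec degree_below :: "nat \<Rightarrow> ('g::ab_semigroup_add \<Rightarrow> 'b::ab_group_add) \<Rightarrow> bool"
  where "degree_below 0 f \<longleftrightarrow> (\<forall>x. f x = 0)"
  | "degree_below (Suc n) f \<longleftrightarrow> (\<forall>h. degree_below n (difference h f))"

lemma degree_below_iff_foldr:
  "degree_below n f \<longleftrightarrow> (\<forall>hs. length hs = n \<longrightarrow> (\<forall>x. foldr difference hs f x = 0))"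
proof (induction n arbitrary: f)
  case (Suc n)
  have "(\<forall>hs. length hs = Suc n \<longrightarrow> P hs) \<longleftrightarrow> (\<forall>h ks. length ks = n \<longrightarrow> P (ks @ [h]))"
    for P :: "'a list \<Rightarrow> bool"
    by (metis length_append_singleton length_Suc_conv_rev)
  then show ?case
    by (simp add: Suc.IH)
qed simp

lemma degree_below_Suc: "degree_below n f \<Longrightarrow> degree_below (Suc n) f"
  by (induction n arbitrary: f) (auto simp: difference_def)

lemma degree_below_mono: "degree_below m f \<Longrightarrow> m \<le> n \<Longrightarrow> degree_below n f"
  by (rule dec_induct) (auto intro: degree_below_Suc simp del: degree_below.simps(2))

lemma degree_below_difference: "degree_below n f \<Longrightarrow> degree_below (n - 1) (difference h f)"
  by (cases n) (auto simp: difference_def)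

lemma degree_below_add:
  "degree_below n f \<Longrightarrow> degree_below n g \<Longrightarrow> degree_below n (\<lambda>x. f x + g x)"
proof (induction n arbitrary: f g)
  case (Suc n)
  have "difference h (\<lambda>x. f x + g x) = (\<lambda>x. difference h f x + difference h g x)" for h
    by (simp add: difference_def fun_eq_iff algebra_simps)
  with Suc show ?case by simp
qed simp

lemma degree_below_additive_image:
  assumes "\<And>x y. u (x - y) = u x - u y"
  shows "degree_below n f \<Longrightarrow> degree_below n (\<lambda>x. u (f x))"
proof (induction n arbitrary: f)
  case 0
  then show ?case using assms[of 0 0] by simp
next
  case (Suc n)
  have "difference h (\<lambda>x. u (f x)) = (\<lambda>x. u (difference h f x))" for h
    by (simp add: difference_def assms)
  with Suc show ?case by simp
qed

lemma degree_below_diff: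
  "degree_below n f \<Longrightarrow> degree_below n g \<Longrightarrow> degree_below n (\<lambda>x. f x - g x)"
  using degree_below_add[of n f "\<lambda>x. - g x"] degree_below_additive_image[of uminus n g] by simp

lemma degree_below_scale:
  "degree_below n f \<Longrightarrow> degree_below n (\<lambda>x. c * f x)" for c :: "'b::ring"
  by (rule degree_below_additive_image) (simp add: right_diff_distrib)

lemma degree_below_sum:
  "(\<And>i. i \<in> I \<Longrightarrow> degree_below n (f i)) \<Longrightarrow> degree_below n (\<lambda>x. \<Sum>i\<in>I. f i x)"
proof (induction I rule: infinite_finite_induct)
  case (insert i I)
  then show ?case by (simp add: degree_below_add)
next
qed (auto intro: degree_below_mono[of 0])

text \<open>
  This is the product rule \<open>\<Delta>\<^sub>h(f g) = \<Delta>\<^sub>h f \<cdot> g + f \<cdot> \<Delta>\<^sub>h g + \<Delta>\<^sub>h f \<cdot> \<Delta>\<^sub>h g\<close>. The bound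
  \<open>m + n\<close> is not sharp, but it is the one that induction on \<open>m + n\<close> gives directly.
\<close>

lemma degree_below_mult:
  fixes f g :: "'g::ab_semigroup_add \<Rightarrow> 'b::comm_ring"
  shows "degree_below m f \<Longrightarrow> degree_below n g \<Longrightarrow> degree_below (m + n) (\<lambda>x. f x * g x)"
proof (induction "m + n" arbitrary: m n f g)
  case (Suc k)
  show ?case
  proof (cases "m = 0 \<or> n = 0")
    case True
    then have "degree_below 0 (\<lambda>x. f x * g x)"
      using Suc.prems by auto
    then show ?thesis by (rule degree_below_mono) simp
  next
    case False
    then obtain m' n' where mn: "m = Suc m'" "n = Suc n'"
      by (auto simp: gr0_conv_Suc)
    have "degree_below k (difference h (\<lambda>x. f x * g x))" for h
    proof -
      let ?df = "difference h f" and ?dg = "difference h g"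
      have d: "degree_below m' ?df" "degree_below n' ?dg"
        using Suc.prems mn by auto
      have "degree_below k (\<lambda>x. ?df x * g x)"
        using Suc.hyps(1)[of m' n ?df g] Suc.hyps(2) Suc.prems d mn by simp
      moreover have "degree_below k (\<lambda>x. f x * ?dg x)"
        using Suc.hyps(1)[of m n' f ?dg] Suc.hyps(2) Suc.prems d mn by simp
      moreover have "degree_below k (\<lambda>x. ?df x * ?dg x)"
        using Suc.hyps(1)[of m' n ?df ?dg] Suc.hyps(2) d mn degree_below_Suc[of n' ?dg]
        by (simp del: degree_below.simps)
      moreover have "difference h (\<lambda>x. f x * g x)
          = (\<lambda>x. ?df x * g x + f x * ?dg x + ?df x * ?dg x)"
        by (simp add: difference_def fun_eq_iff algebra_simps)
      ultimately show ?thesis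
        by (simp add: degree_below_add)
    qed
    then show ?thesis
      using Suc.hyps(2) by (metis degree_below.simps(2))
  qed
qed simp

text \<open>
  For a homogeneous polynomial \<open>f\<close> of degree \<open>n\<close> on \<open>\<real>\<^sup>k\<close>, the leading part of \<open>\<Delta>\<^sub>h f\<close> is \<open>\<Sum>\<^sub>i h\<^sub>i \<partial>\<^sub>i f\<close>, and
  Euler's identity says \<open>\<Sum>\<^sub>i x\<^sub>i \<partial>\<^sub>i f = n f\<close>. Here the \<open>b i\<close> stand for the partial derivatives. The
  proof applies \<open>\<Delta>\<^sub>h\<close> to the claim: the hypotheses pass from \<open>f\<close> and \<open>b i\<close> to \<open>\<Delta>\<^sub>h f\<close> and \<open>\<Delta>\<^sub>h (b i)\<close>
  with the degree lowered by one, so the induction hypothesis contributes \<open>n - 1\<close> copies of \<open>\<Delta>\<^sub>h f\<close>,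
  and the term \<open>\<Sum>\<^sub>i a\<^sub>i(h) b\<^sub>i\<close> of the product rule contributes the last one.
\<close>

lemma euler_identity_mod_lower_degree:
  fixes f :: "'g::ab_semigroup_add \<Rightarrow> 'b::comm_ring_1"
  assumes additive: "\<And>i x y. i \<in> I \<Longrightarrow> a i (x + y) = a i x + a i y"
  shows "degree_below (Suc n) f \<Longrightarrow> (\<And>i. i \<in> I \<Longrightarrow> degree_below n (b i)) \<Longrightarrow>
    (\<And>h. degree_below (n - 1) (\<lambda>x. difference h f x - (\<Sum>i\<in>I. a i h * b i x))) \<Longrightarrow>
    degree_below n (\<lambda>x. (\<Sum>i\<in>I. a i x * b i x) - of_nat n * f x)"
proof (induction n arbitrary: f b)
  case 0
  then show ?case by simp
next
  case (Suc m)
  let ?E = "\<lambda>b x. \<Sum>i\<in>I. a i x * b i x"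
  have "degree_below m (difference h (\<lambda>x. ?E b x - of_nat (Suc m) * f x))" for h
  proof -
    let ?df = "difference h f" and ?db = "\<lambda>i. difference h (b i)"
    have db: "degree_below m (?db i)" if "i \<in> I" for i
      using Suc.prems(2)[OF that] by simp
    have rem: "degree_below (m - 1) (\<lambda>x. difference k ?df x - (\<Sum>i\<in>I. a i k * ?db i x))" for k
    proof -
      have "difference h (\<lambda>x. difference k f x - (\<Sum>i\<in>I. a i k * b i x))
          = (\<lambda>x. difference k ?df x - (\<Sum>i\<in>I. a i k * ?db i x))"
        by (simp add: difference_def fun_eq_iff sum_subtractf right_diff_distrib add.assoc
            add.commute[of h k])
      then show ?thesis
        using degree_below_difference[OF Suc.prems(3)[of k], of h] by simp
    qed
    have "degree_below m (\<lambda>x. ?E ?db x - of_nat m * ?df x)"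
      using Suc.IH[of ?df ?db] Suc.prems(1) db rem by simp
    moreover have "degree_below m (\<lambda>x. ?df x - (\<Sum>i\<in>I. a i h * b i x))"
      using Suc.prems(3)[of h] by simp
    moreover have "degree_below m (\<lambda>x. \<Sum>i\<in>I. a i h * ?db i x)"
      by (intro degree_below_sum degree_below_scale db)
    moreover have "difference h (\<lambda>x. ?E b x - of_nat (Suc m) * f x)
      = (\<lambda>x. (?E ?db x - of_nat m * ?df x) - (?df x - (\<Sum>i\<in>I. a i h * b i x))
          + (\<Sum>i\<in>I. a i h * ?db i x))"
    proof
      fix x
      have "?E b (x + h) = ?E b x + ?E ?db x + (\<Sum>i\<in>I. a i h * b i x) + (\<Sum>i\<in>I. a i h * ?db i x)"
        unfolding sum.distrib[symmetric]
        by (rule sum.cong) (auto simp: additive difference_def algebra_simps)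
      then show "difference h (\<lambda>x. ?E b x - of_nat (Suc m) * f x) x
        = (?E ?db x - of_nat m * ?df x) - (?df x - (\<Sum>i\<in>I. a i h * b i x))
          + (\<Sum>i\<in>I. a i h * ?db i x)"
        by (simp add: difference_def algebra_simps)
    qed
    ultimately show ?thesis
      by (simp add: degree_below_add degree_below_diff)
  qed
  then show ?case by simp
qed

section \<open>The algebra of complex polynomials\<close>

definition eval_monomial :: "(nat \<Rightarrow> complex) \<Rightarrow> (nat \<Rightarrow>\<^sub>0 nat) \<Rightarrow> complex"
  where "eval_monomial z m = (\<Prod>i\<in>Poly_Mapping.keys m. z i ^ Poly_Mapping.lookup m i)"

lemma eval_monomial_superset:
  assumes "finite I" "Poly_Mapping.keys m \<subseteq> I"
  shows "eval_monomial z m = (\<Prod>i\<in>I. z i ^ Poly_Mapping.lookup m i)"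
  unfolding eval_monomial_def
  by (rule prod.mono_neutral_left) (use assms in \<open>auto simp: in_keys_iff\<close>)

lemma eval_monomial_add: "eval_monomial z (m + m') = eval_monomial z m * eval_monomial z m'"
proof -
  let ?I = "Poly_Mapping.keys m \<union> Poly_Mapping.keys m'"
  have "eval_monomial z k = (\<Prod>i\<in>?I. z i ^ Poly_Mapping.lookup k i)" if "k \<in> {m, m', m + m'}" for k
    by (rule eval_monomial_superset) (use that Poly_Mapping.keys_add[of m m'] in auto)
  then show ?thesis
    by (simp add: lookup_add power_add prod.distrib)
qed

lemma eval_mpoly_superset:
  assumes "finite M" "Poly_Mapping.keys P \<subseteq> M"
  shows "eval_mpoly P z = (\<Sum>m\<in>M. Poly_Mapping.lookup P m * eval_monomial z m)"
  unfolding eval_mpoly_def eval_monomial_def[symmetric]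
  by (rule sum.mono_neutral_left) (use assms in \<open>auto simp: in_keys_iff\<close>)

lemma eval_mpoly_add: "eval_mpoly (P + Q) z = eval_mpoly P z + eval_mpoly Q z"
proof -
  let ?M = "Poly_Mapping.keys P \<union> Poly_Mapping.keys Q"
  have "eval_mpoly R z = (\<Sum>m\<in>?M. Poly_Mapping.lookup R m * eval_monomial z m)"
    if "R \<in> {P, Q, P + Q}" for R
    by (rule eval_mpoly_superset) (use that Poly_Mapping.keys_add[of P Q] in auto)
  then show ?thesis
    by (simp add: lookup_add distrib_right sum.distrib)
qed

lemma eval_mpoly_single: "eval_mpoly (Poly_Mapping.single m c) z = c * eval_monomial z m"
  using eval_mpoly_superset[of "{m}" "Poly_Mapping.single m c" z] by simp

lemma eval_mpoly_sum: "eval_mpoly (sum P I) z = (\<Sum>i\<in>I. eval_mpoly (P i) z)"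
  by (induction I rule: infinite_finite_induct) (simp_all add: eval_mpoly_add, simp_all add: eval_mpoly_def)

lemma mpoly_eq_sum_single:
  "P = (\<Sum>m\<in>Poly_Mapping.keys P. Poly_Mapping.single m (Poly_Mapping.lookup P m))"
  for P :: complex_mpoly
  by (rule poly_mapping_eqI) (auto simp: lookup_sum lookup_single when_def in_keys_iff)

lemma eval_mpoly_mult: "eval_mpoly (P * Q) z = eval_mpoly P z * eval_mpoly Q z"
proof -
  let ?s = "\<lambda>P m. Poly_Mapping.single m (Poly_Mapping.lookup P m) :: complex_mpoly"
  have "P * Q = (\<Sum>m\<in>Poly_Mapping.keys P. \<Sum>k\<in>Poly_Mapping.keys Q. ?s P m * ?s Q k)"
    by (subst mpoly_eq_sum_single[of P], subst mpoly_eq_sum_single[of Q]) (rule sum_product)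
  also have "eval_mpoly \<dots> z
      = (\<Sum>m\<in>Poly_Mapping.keys P. \<Sum>k\<in>Poly_Mapping.keys Q. eval_mpoly (?s P m) z * eval_mpoly (?s Q k) z)"
    by (simp add: eval_mpoly_sum mult_single eval_mpoly_single eval_monomial_add mult_ac)
  also have "\<dots> = eval_mpoly (\<Sum>m\<in>Poly_Mapping.keys P. ?s P m) z * eval_mpoly (\<Sum>k\<in>Poly_Mapping.keys Q. ?s Q k) z"
    by (simp add: eval_mpoly_sum sum_product)
  finally show ?thesis
    by (simp flip: mpoly_eq_sum_single)
qed

lemma in_variables_add: "in_variables n P \<Longrightarrow> in_variables n Q \<Longrightarrow> in_variables n (P + Q)"
  unfolding in_variables_def using Poly_Mapping.keys_add[of P Q] by blast

lemma in_variables_mult: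
  assumes "in_variables n P" "in_variables n Q"
  shows "in_variables n (P * Q)"
  unfolding in_variables_def
proof
  fix m assume "m \<in> Poly_Mapping.keys (P * Q)"
  then obtain p q where m: "m = p + q" "p \<in> Poly_Mapping.keys P" "q \<in> Poly_Mapping.keys Q"
    using keys_mult[of P Q] by blast
  then show "Poly_Mapping.keys m \<subseteq> {..<n}"
    using assms Poly_Mapping.keys_add[of p q] unfolding in_variables_def by blast
qed

text \<open>
  The set \<open>R\<close> abstracts over what one wants to know of a polynomial in the \<open>a i\<close>: below it is
  instantiated both with the polynomials in a larger family of additive functions and with the
  functions of finite degree.
\<close>

lemma eval_mpoly_in_algebra:
  assumes const: "\<And>c. (\<lambda>_. c) \<in> R"
    and add: "\<And>f g. f \<in> R \<Longrightarrow> g \<in> R \<Longrightarrow> (\<lambda>x. f x + g x) \<in> R"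
    and mult: "\<And>f g. f \<in> R \<Longrightarrow> g \<in> R \<Longrightarrow> (\<lambda>x. f x * g x) \<in> R"
    and "in_variables n P" and a: "\<And>i. i < n \<Longrightarrow> a i \<in> R"
  shows "(\<lambda>x. eval_mpoly P (\<lambda>i. a i x)) \<in> R"
proof -
  have pow: "(\<lambda>x. f x ^ k) \<in> R" if "f \<in> R" for f k
    by (induction k) (auto intro: const mult that)
  have prod: "(\<lambda>x. \<Prod>i\<in>I. f i x) \<in> R" if "\<And>i. i \<in> I \<Longrightarrow> f i \<in> R" for f and I :: "nat set"
    using that by (induction I rule: infinite_finite_induct) (auto intro: const mult)
  have sum: "(\<lambda>x. \<Sum>i\<in>I. f i x) \<in> R" if "\<And>i. i \<in> I \<Longrightarrow> f i \<in> R" for f and I :: "(nat \<Rightarrow>\<^sub>0 nat) set"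
    using that by (induction I rule: infinite_finite_induct) (auto intro: const add)
  show ?thesis
    unfolding eval_mpoly_def
  proof (intro sum mult const prod pow a)
    fix m i assume "m \<in> Poly_Mapping.keys P" "i \<in> Poly_Mapping.keys m"
    then show "i < n" using assms(4) by (auto simp: in_variables_def)
  qed
qed

lemma is_complex_polynomial_const: "is_complex_polynomial (\<lambda>_. c)"
  unfolding is_complex_polynomial_def
  by (rule exI[of _ 0], rule exI, rule exI[of _ "Poly_Mapping.single 0 c"])
    (simp add: in_variables_def eval_mpoly_single eval_monomial_def)

lemma is_complex_polynomial_additive:
  assumes "continuous_additive a"
  shows "is_complex_polynomial a"
  unfolding is_complex_polynomial_def
  by (rule exI[of _ 1], rule exI[of _ "\<lambda>_. a"],
      rule exI[of _ "Poly_Mapping.single (Poly_Mapping.single 0 1) 1"])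
    (simp add: assms in_variables_def eval_mpoly_single eval_monomial_def)

text \<open>
  The two functions may involve different families of additive functions. Both are rewritten as
  polynomials in the concatenated family \<open>c\<close>. For the second family this amounts to a renaming
  of variables, which comes for free because the polynomials in \<open>c\<close> form an algebra.
\<close>

lemma is_complex_polynomial_add_mult:
  assumes "is_complex_polynomial f" "is_complex_polynomial g"
  shows "is_complex_polynomial (\<lambda>x. f x + g x)" "is_complex_polynomial (\<lambda>x. f x * g x)"
proof -
  obtain m a P where f: "\<And>i. i < m \<Longrightarrow> continuous_additive (a i)" "in_variables m P"
      "f = (\<lambda>x. eval_mpoly P (\<lambda>i. a i x))"
    using assms(1) unfolding is_complex_polynomial_def by blast
  obtain n b Q where g: "\<And>i. i < n \<Longrightarrow> continuous_additive (b i)" "in_variables n Q"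
      "g = (\<lambda>x. eval_mpoly Q (\<lambda>i. b i x))"
    using assms(2) unfolding is_complex_polynomial_def by blast
  define c where "c i = (if i < m then a i else b (i - m))" for i
  have c: "continuous_additive (c i)" if "i < m + n" for i
    using f(1) g(1) that by (auto simp: c_def)
  define R where "R = {\<lambda>x. eval_mpoly S (\<lambda>i. c i x) | S. in_variables (m + n) S}"
  have R: "is_complex_polynomial h" if "h \<in> R" for h
    using that c unfolding R_def is_complex_polynomial_def by blast
  have const: "(\<lambda>_. k) \<in> R" for k
    unfolding R_def
    by (rule CollectI, rule exI[of _ "Poly_Mapping.single 0 k"])
      (simp add: in_variables_def eval_mpoly_single eval_monomial_def)
  have add: "(\<lambda>x. h x + k x) \<in> R" if "h \<in> R" "k \<in> R" for h k
    using that in_variables_add unfolding R_def by (force simp: eval_mpoly_add[symmetric])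
  have mult: "(\<lambda>x. h x * k x) \<in> R" if "h \<in> R" "k \<in> R" for h k
    using that in_variables_mult unfolding R_def by (force simp: eval_mpoly_mult[symmetric])
  have var: "c i \<in> R" if "i < m + n" for i
    unfolding R_def
    by (rule CollectI, rule exI[of _ "Poly_Mapping.single (Poly_Mapping.single i 1) 1"])
      (simp add: that in_variables_def eval_mpoly_single eval_monomial_def)
  have "f \<in> R"
    unfolding f(3)
  proof (rule eval_mpoly_in_algebra[OF const add mult f(2)])
    show "a i \<in> R" if "i < m" for i
      using var[of i] that by (simp add: c_def)
  qed
  moreover have "g \<in> R"
    unfolding g(3)
  proof (rule eval_mpoly_in_algebra[OF const add mult g(2)])
    show "b i \<in> R" if "i < n" for i
      using var[of "m + i"] that by (simp add: c_def)
  qed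
  ultimately show "is_complex_polynomial (\<lambda>x. f x + g x)" "is_complex_polynomial (\<lambda>x. f x * g x)"
    using R add mult by blast+
qed

lemma is_complex_polynomial_sum:
  "(\<And>i. i \<in> I \<Longrightarrow> is_complex_polynomial (f i)) \<Longrightarrow> is_complex_polynomial (\<lambda>x. \<Sum>i\<in>I. f i x)"
  by (induction I rule: infinite_finite_induct)
    (auto intro: is_complex_polynomial_const is_complex_polynomial_add_mult)

lemma is_complex_polynomial_imp_degree_below:
  assumes "is_complex_polynomial f"
  shows "\<exists>n. degree_below n f"
proof -
  obtain n a P where f: "\<And>i. i < n \<Longrightarrow> continuous_additive (a i)" "in_variables n P"
      "f = (\<lambda>x. eval_mpoly P (\<lambda>i. a i x))"
    using assms unfolding is_complex_polynomial_def by blast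
  have "f \<in> {f. \<exists>n. degree_below n f}"
    unfolding f(3)
  proof (rule eval_mpoly_in_algebra[OF _ _ _ f(2)])
    show "(\<lambda>_. c) \<in> {f. \<exists>n. degree_below n f}" for c
      by (auto intro!: exI[of _ "Suc 0"] simp: difference_def)
    show "a i \<in> {f. \<exists>n. degree_below n f}" if "i < n" for i
      using f(1)[OF that]
      by (auto intro!: exI[of _ "Suc (Suc 0)"] simp: difference_def continuous_additive_def)
    fix f g :: "'a \<Rightarrow> complex"
    assume "f \<in> {f. \<exists>n. degree_below n f}" "g \<in> {f. \<exists>n. degree_below n f}"
    then obtain m n where mn: "degree_below m f" "degree_below n g" by auto
    then have "degree_below (m + n) (\<lambda>x. f x + g x)"
      by (intro degree_below_add) (auto elim: degree_below_mono)
    moreover have "degree_below (m + n) (\<lambda>x. f x * g x)"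
      using mn by (rule degree_below_mult)
    ultimately show "(\<lambda>x. f x + g x) \<in> {f. \<exists>n. degree_below n f}"
      "(\<lambda>x. f x * g x) \<in> {f. \<exists>n. degree_below n f}"
      by blast+
  qed
  then show ?thesis by simp
qed

section \<open>Finite-dimensional spaces of functions\<close>

lemma complex_fun_span_map:
  assumes "\<And>v w. L (v + w) = L v + L w" "\<And>c v. L (fun_scaleC c v) = fun_scaleC c (L v)"
    and "\<And>b. b \<in> B \<Longrightarrow> L b \<in> complex_fun.span C" and "v \<in> complex_fun.span B"
  shows "L v \<in> complex_fun.span C"
proof -
  have "L 0 = 0" using assms(1)[of 0 0] by simp
  then have "complex_fun.span B \<subseteq> {v. L v \<in> complex_fun.span C}"
    using assms(1-3)
    by (intro complex_fun.span_minimal)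
      (auto simp: complex_fun.subspace_def complex_fun.span_zero
        intro: complex_fun.span_add complex_fun.span_scale)
  then show ?thesis using assms(4) by blast
qed

lemma translate_linear:
  "translate g (v + w) = translate g v + translate g w"
  "translate g (fun_scaleC c v) = fun_scaleC c (translate g v)"
  by (simp_all add: translate_def fun_scaleC_def fun_eq_iff)

lemma continuous_on_complex_fun_span:
  fixes B :: "('g::topological_space \<Rightarrow> 'e::complex_normed_vector) set"
  assumes "\<And>b. b \<in> B \<Longrightarrow> continuous_on UNIV b" "v \<in> complex_fun.span B"
  shows "continuous_on UNIV v"
  using assms(2)
proof (induction rule: complex_fun.span_induct_alt)
  case base
  then show ?case by (simp add: zero_fun_def)
next
  case (step c b v)
  have "bounded_linear (\<lambda>x::'e. c *\<^sub>C x)"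
    by (rule bounded_linear_intro[of _ "cmod c"])
      (simp_all add: scaleC_add_right scaleC_scaleC norm_scaleC mult.commute flip: scaleC_of_real)
  then have "continuous_on UNIV (\<lambda>x. c *\<^sub>C b x)"
    using assms(1)[OF step(1)] by (rule bounded_linear.continuous_on)
  then show ?case
    using step by (simp add: fun_scaleC_def plus_fun_def continuous_on_add)
qed

text \<open>
  The linear functionals in the span of the point evaluations have these properties. Only the properties
  matter, so they serve as the definition: linearity makes coordinates of \<open>\<Delta>\<^sub>h f\<close> additive
  where \<open>\<Delta>\<^sub>h f\<close> is, and the last condition makes them continuous in \<open>h\<close>.
\<close>

definition coordinate_functional :: "(('g::topological_comm_monoid_add \<Rightarrow> complex) \<Rightarrow> complex) \<Rightarrow> bool"
  where "coordinate_functional e \<longleftrightarrow>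
    (\<forall>v w. e (v + w) = e v + e w) \<and> (\<forall>c v. e (fun_scaleC c v) = c * e v) \<and>
    (\<forall>v. continuous_on UNIV v \<longrightarrow> continuous_on UNIV (\<lambda>g. e (translate g v)))"

lemma coordinate_functional_eval: "coordinate_functional (\<lambda>v. v y)"
proof -
  have "continuous_on UNIV (\<lambda>g. v (y + g))" if "continuous_on UNIV v" for v :: "'a \<Rightarrow> complex"
    using that by (auto intro!: continuous_on_compose2[OF that] continuous_intros)
  then show ?thesis
    by (simp add: coordinate_functional_def fun_scaleC_def scaleC_complex_def translate_def)
qed

lemma coordinate_functional_combine:
  assumes "coordinate_functional e" "coordinate_functional e'"
  shows "coordinate_functional (\<lambda>v. c * e v + c' * e' v)"
  using assms unfolding coordinate_functional_def
  by (auto simp: algebra_simps intro!: continuous_intros)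

lemma coordinate_functional_zero_on_span:
  assumes e: "coordinate_functional e" and "\<And>b. b \<in> B \<Longrightarrow> e b = 0"
    and "v \<in> complex_fun.span B"
  shows "e v = 0"
proof -
  have "e (fun_scaleC 0 0) = 0 * e 0"
    using e unfolding coordinate_functional_def by blast
  then have "complex_fun.span B \<subseteq> {v. e v = 0}"
    using assms(1,2) by (intro complex_fun.span_minimal)
      (auto simp: complex_fun.subspace_def coordinate_functional_def)
  then show ?thesis using assms(3) by blast
qed

text \<open>
  On a finite-dimensional space of functions the point evaluations span the dual. The
  proof is a form of Gaussian elimination: a functional \<open>p\<close> dual to \<open>c\<close> is used to remove
  the \<open>c\<close>-component of \<open>b\<close> and to correct a functional obtained for \<open>B\<close> so that it vanishes at \<open>c\<close> as well.
\<close>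

lemma coordinate_functional_separates:
  assumes "finite B" "b \<notin> complex_fun.span B"
  shows "\<exists>e. coordinate_functional e \<and> (\<forall>v\<in>B. e v = 0) \<and> e b = 1"
  using assms
proof (induction B arbitrary: b)
  case empty
  then have "b \<noteq> 0" by simp
  then obtain y where "b y \<noteq> 0" by (auto simp: fun_eq_iff)
  then show ?case
    using coordinate_functional_combine[OF coordinate_functional_eval coordinate_functional_eval,
        of "1 / b y" y 0 y]
    by (intro exI[of _ "\<lambda>v. (1 / b y) * v y + 0 * v y"]) auto
next
  case (insert c B)
  show ?case
  proof (cases "c \<in> complex_fun.span B")
    case True
    then have "b \<notin> complex_fun.span B"
      using insert.prems complex_fun.span_redundant by blast
    then obtain e where "coordinate_functional e" "\<forall>v\<in>B. e v = 0" "e b = 1"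
      using insert.IH by blast
    then show ?thesis
      using True coordinate_functional_zero_on_span[of e B c] by auto
  next
    case False
    then obtain p where p: "coordinate_functional p" "\<forall>v\<in>B. p v = 0" "p c = 1"
      using insert.IH by blast
    define b' where "b' = b - fun_scaleC (p b) c"
    have b: "b = b' + fun_scaleC (p b) c" by (simp add: b'_def)
    have "b' \<notin> complex_fun.span B"
      using insert.prems complex_fun.span_breakdown_eq[of b c B] unfolding b'_def by blast
    then obtain e where e: "coordinate_functional e" "\<forall>v\<in>B. e v = 0" "e b' = 1"
      using insert.IH by blast
    let ?e = "\<lambda>v. 1 * e v + (- e c) * p v"
    have "e b = e b' + p b * e c"
      using e(1) by (subst b) (simp add: coordinate_functional_def)
    then have "?e b = 1" using e(3) by simp
    moreover have "\<forall>v\<in>insert c B. ?e v = 0" using e p by simp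
    ultimately show ?thesis
      using coordinate_functional_combine[OF e(1) p(1)] by (intro exI[of _ ?e]) blast
  qed
qed

lemma coordinate_functionals_of_basis:
  assumes "finite B" "complex_fun.independent B"
  obtains e where "\<And>b. b \<in> B \<Longrightarrow> coordinate_functional (e b)"
    and "\<And>b b'. b \<in> B \<Longrightarrow> b' \<in> B \<Longrightarrow> e b b' = (if b' = b then 1 else 0)"
    and "\<And>v x. v \<in> complex_fun.span B \<Longrightarrow> v x = (\<Sum>b\<in>B. e b v * b x)"
proof -
  have "\<exists>e. coordinate_functional e \<and> (\<forall>v\<in>B - {b}. e v = 0) \<and> e b = 1" if "b \<in> B" for b
    by (rule coordinate_functional_separates)
      (use assms that in \<open>auto simp: complex_fun.dependent_def\<close>)
  then obtain e where e: "\<And>b. b \<in> B \<Longrightarrow>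
      coordinate_functional (e b) \<and> (\<forall>v\<in>B - {b}. e b v = 0) \<and> e b b = 1"
    by metis
  then have delta: "e b b' = (if b' = b then 1 else 0)" if "b \<in> B" "b' \<in> B" for b b'
    using that by auto
  have expand: "v x = (\<Sum>b\<in>B. e b v * b x)" if "v \<in> complex_fun.span B" for v x
    using that
  proof (induction rule: complex_fun.span_induct_alt)
    case base
    have "e b 0 = 0" if "b \<in> B" for b
      using coordinate_functional_zero_on_span[of "e b" "{}" 0] e[OF that] complex_fun.span_zero by blast
    then have "(\<Sum>b\<in>B. e b 0 * b x) = 0" by (intro sum.neutral) auto
    then show ?case by (metis zero_fun_apply)
  next
    case (step c b v)
    have "(\<Sum>b'\<in>B. e b' (fun_scaleC c b + v) * b' x) = (\<Sum>b'\<in>B. c * (e b' b * b' x) + e b' v * b' x)"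
      by (rule sum.cong) (use e in \<open>auto simp: coordinate_functional_def algebra_simps\<close>)
    also have "\<dots> = c * (\<Sum>b'\<in>B. e b' b * b' x) + (\<Sum>b'\<in>B. e b' v * b' x)"
      by (simp add: sum.distrib sum_distrib_left)
    also have "(\<Sum>b'\<in>B. e b' b * b' x) = (\<Sum>b'\<in>B. if b' = b then b' x else 0)"
      by (rule sum.cong) (use delta step(1) in auto)
    also have "\<dots> = b x" using assms(1) step(1) by simp
    finally show ?case
      using step by (simp add: fun_scaleC_def scaleC_complex_def)
  qed
  show ?thesis using that[of e] e delta expand by blast
qed

lemma sum_fun_eval: "(\<Sum>i\<in>I. f i) x = (\<Sum>i\<in>I. f i x)" for f :: "'i \<Rightarrow> 'g \<Rightarrow> complex"
  by (induction I rule: infinite_finite_induct) simp_all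

text \<open>
  The functions \<open>\<Delta>\<^sub>h f\<close> lie in the space \<open>W n\<close> of members of degree below \<open>n\<close>, and \<open>\<Delta>\<^sub>h \<Delta>\<^sub>g f\<close> lies in
  \<open>W (n - 1)\<close>. A basis \<open>C\<close> of the latter extends to a basis \<open>D\<close> of the former; the coordinates of
  \<open>\<Delta>\<^sub>h f\<close> at the members of \<open>D - C\<close> ignore \<open>W (n - 1)\<close> and are therefore additive in \<open>h\<close>.
\<close>

lemma leading_part_of_differences:
  fixes f :: "'g::topological_comm_monoid_add \<Rightarrow> complex"
  assumes "finite B" and cont: "\<And>b. b \<in> B \<Longrightarrow> continuous_on UNIV b"
    and inv: "\<And>g v. v \<in> complex_fun.span B \<Longrightarrow> translate g v \<in> complex_fun.span B"
    and f: "f \<in> complex_fun.span B" "degree_below (Suc n) f"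
  obtains I a where "finite I" "I \<subseteq> complex_fun.span B"
    and "\<And>b. b \<in> I \<Longrightarrow> degree_below n b" "\<And>b. b \<in> I \<Longrightarrow> continuous_additive (a b)"
    and "\<And>h. degree_below (n - 1) (\<lambda>x. difference h f x - (\<Sum>b\<in>I. a b h * b x))"
proof -
  let ?V = "complex_fun.span B"
  define W where "W k = {v \<in> ?V. degree_below k v}" for k
  have inv': "difference h v \<in> ?V" if "v \<in> ?V" for h v
  proof -
    have "difference h v = translate h v - v" by (simp add: difference_def translate_def fun_eq_iff)
    then show ?thesis using inv that complex_fun.span_diff by metis
  qed
  have W: "complex_fun.subspace (W k)" for k
  proof -
    have "degree_below k (v + w)" if "degree_below k v" "degree_below k w" for v w :: "'g \<Rightarrow> complex"
      using degree_below_add[OF that] by (simp add: plus_fun_def)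
    moreover have "degree_below k (fun_scaleC c v)" if "degree_below k v" for c and v :: "'g \<Rightarrow> complex"
      using degree_below_scale[OF that] by (simp add: fun_scaleC_def scaleC_complex_def)
    moreover have "degree_below k (0 :: 'g \<Rightarrow> complex)"
      by (rule degree_below_mono[of 0]) auto
    ultimately show ?thesis
      by (auto simp: complex_fun.subspace_def W_def complex_fun.span_zero
          intro: complex_fun.span_add complex_fun.span_scale)
  qed
  obtain C where C: "C \<subseteq> W (n - 1)" "complex_fun.independent C" "W (n - 1) \<subseteq> complex_fun.span C"
    using complex_fun.maximal_independent_subset by blast
  have "W (n - 1) \<subseteq> W n" by (auto simp: W_def intro: degree_below_mono)
  then have "C \<subseteq> W n" using C by blast
  then obtain D where D: "C \<subseteq> D" "D \<subseteq> W n" "complex_fun.independent D" "W n \<subseteq> complex_fun.span D"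
    using C(2) complex_fun.maximal_independent_subset_extend by blast
  have "finite D"
    using complex_fun.independent_span_bound[OF \<open>finite B\<close> D(3)] D(2) by (auto simp: W_def)
  then obtain e where e: "\<And>b. b \<in> D \<Longrightarrow> coordinate_functional (e b)"
    and delta: "\<And>b b'. b \<in> D \<Longrightarrow> b' \<in> D \<Longrightarrow> e b b' = (if b' = b then 1 else 0)"
    and expand: "\<And>v x. v \<in> complex_fun.span D \<Longrightarrow> v x = (\<Sum>b\<in>D. e b v * b x)"
    using coordinate_functionals_of_basis D(3) by blast
  have dW: "difference h f \<in> W n" for h
    using f inv' by (simp add: W_def)
  define a where "a b h = e b (difference h f)" for b h
  show ?thesis
  proof (rule that[of "D - C" a])
    show "finite (D - C)" "D - C \<subseteq> ?V" using \<open>finite D\<close> D(2) by (auto simp: W_def)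
    show "degree_below n b" if "b \<in> D - C" for b using that D(2) by (auto simp: W_def)
    show "continuous_additive (a b)" if "b \<in> D - C" for b
    proof -
      have b: "coordinate_functional (e b)" using e that by blast
      have "a b (g + h) = a b g + a b h" for g h
      proof -
        have "difference h (difference g f) \<in> W (n - 1)"
          using dW[of g] inv' degree_below_difference by (auto simp: W_def)
        then have "difference h (difference g f) \<in> complex_fun.span C"
          using C(3) by blast
        moreover have "e b c = 0" if "c \<in> C" for c
          using delta[of b c] \<open>b \<in> D - C\<close> that D(1) by auto
        ultimately have "e b (difference h (difference g f)) = 0"
          using coordinate_functional_zero_on_span[OF b] by blast
        moreover have "difference (g + h) f
            = difference g f + difference h f + difference h (difference g f)"
          by (simp add: difference_def fun_eq_iff algebra_simps)
        ultimately show ?thesis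
          using b unfolding a_def coordinate_functional_def by simp
      qed
      moreover have "continuous_on UNIV (a b)"
      proof -
        have "a b h = e b (translate h f) - e b f" for h
        proof -
          have "translate h f = difference h f + f"
            by (simp add: difference_def translate_def fun_eq_iff)
          then show ?thesis using b unfolding a_def coordinate_functional_def by simp
        qed
        moreover have "continuous_on UNIV (\<lambda>h. e b (translate h f))"
          using b continuous_on_complex_fun_span[OF cont f(1)]
          unfolding coordinate_functional_def by blast
        ultimately show ?thesis by (simp add: continuous_on_diff)
      qed
      ultimately show ?thesis by (simp add: continuous_additive_def)
    qed
    show "degree_below (n - 1) (\<lambda>x. difference h f x - (\<Sum>b\<in>D - C. a b h * b x))" for h
    proof -
      have "difference h f x = (\<Sum>b\<in>D - C. a b h * b x) + (\<Sum>b\<in>C. a b h * b x)" for x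
      proof -
        have "difference h f \<in> complex_fun.span D" using dW D(4) by blast
        then have "difference h f x = (\<Sum>b\<in>D. a b h * b x)" unfolding a_def by (rule expand)
        then show ?thesis using sum.subset_diff[OF D(1) \<open>finite D\<close>] by simp
      qed
      then have "(\<lambda>x. difference h f x - (\<Sum>b\<in>D - C. a b h * b x)) = (\<lambda>x. \<Sum>b\<in>C. a b h * b x)"
        by simp
      moreover have "degree_below (n - 1) \<dots>"
        using C(1) by (intro degree_below_sum degree_below_scale) (auto simp: W_def)
      ultimately show ?thesis by simp
    qed
  qed
qed

section \<open>From polynomials to w-polynomials\<close>

text \<open>
  The set \<open>B\<close> varies in the induction: the remainder \<open>r\<close> in Euler's identity has lower degree than \<open>f\<close>, but it
  involves products \<open>a b * b\<close> that need not lie in the span of \<open>B\<close>. Division by \<open>m\<close> is what makes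
  the constant case \<open>m = 0\<close> separate.
\<close>

lemma is_complex_polynomial_if_degree_below:
  fixes f :: "'g::topological_comm_monoid_add \<Rightarrow> complex"
  shows "finite B \<Longrightarrow> (\<And>b. b \<in> B \<Longrightarrow> continuous_on UNIV b) \<Longrightarrow>
    (\<And>g v. v \<in> complex_fun.span B \<Longrightarrow> translate g v \<in> complex_fun.span B) \<Longrightarrow>
    f \<in> complex_fun.span B \<Longrightarrow> degree_below n f \<Longrightarrow> is_complex_polynomial f"
proof (induction n arbitrary: f B)
  case 0
  then have "f = (\<lambda>_. 0)" by auto
  then show ?case by (simp add: is_complex_polynomial_const)
next
  case (Suc m)
  show ?case
  proof (cases "m = 0")
    case True
    have "f x = f 0" for x
      using Suc.prems(5) True by (simp add: difference_def) (metis add_0 eq_iff_diff_eq_0)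
    then have "f = (\<lambda>_. f 0)" by auto
    then show ?thesis by (metis is_complex_polynomial_const)
  next
    case False
    obtain I a where I: "finite I" "I \<subseteq> complex_fun.span B"
      and deg: "\<And>b. b \<in> I \<Longrightarrow> degree_below m b" and a: "\<And>b. b \<in> I \<Longrightarrow> continuous_additive (a b)"
      and lead: "\<And>h. degree_below (m - 1) (\<lambda>x. difference h f x - (\<Sum>b\<in>I. a b h * b x))"
      using leading_part_of_differences[OF Suc.prems] by blast
    define E where "E x = (\<Sum>b\<in>I. a b x * b x)" for x
    define r where "r x = E x - of_nat m * f x" for x
    have r: "degree_below m r"
      unfolding r_def E_def
      by (rule euler_identity_mod_lower_degree)
        (use a Suc.prems(5) deg lead in \<open>auto simp: continuous_additive_def simp del: degree_below.simps\<close>)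
    have "is_complex_polynomial b" if "b \<in> I" for b
      using Suc.IH[OF Suc.prems(1-3), of b] I(2) deg that by blast
    then have E: "is_complex_polynomial E"
      unfolding E_def
      by (intro is_complex_polynomial_sum is_complex_polynomial_add_mult(2))
        (auto intro: is_complex_polynomial_additive a)
    \<comment> \<open>The products \<open>a b * c\<close> enlarge the span of \<open>B\<close> to a translation-invariant space
      containing \<open>E\<close>, since \<open>T\<^sub>g (a b * c) = a b * T\<^sub>g c + a b g * T\<^sub>g c\<close>.\<close>
    define B' where "B' = B \<union> (\<lambda>(b, c) x. a b x * c x) ` (I \<times> B)"
    have mono: "complex_fun.span B \<subseteq> complex_fun.span B'"
      by (rule complex_fun.span_mono) (simp add: B'_def)
    have prod: "(\<lambda>x. a b x * v x) \<in> complex_fun.span B'" if "b \<in> I" "v \<in> complex_fun.span B" for b v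
      by (rule complex_fun_span_map[where L = "\<lambda>v x. a b x * v x", OF _ _ _ that(2)])
        (use that(1) in \<open>auto simp: B'_def fun_eq_iff fun_scaleC_def scaleC_complex_def algebra_simps
          intro!: complex_fun.span_base\<close>)
    have "is_complex_polynomial r"
    proof (rule Suc.IH[of B' r])
      show "finite B'" using Suc.prems(1) I(1) by (simp add: B'_def)
      show "continuous_on UNIV b" if "b \<in> B'" for b
        using that Suc.prems(2) a by (auto simp: B'_def continuous_additive_def intro!: continuous_intros)
      show "translate g v \<in> complex_fun.span B'" if "v \<in> complex_fun.span B'" for g v
      proof (rule complex_fun_span_map[OF translate_linear _ that])
        fix u assume "u \<in> B'"
        then consider "u \<in> B" | b c where "b \<in> I" "c \<in> B" "u = (\<lambda>x. a b x * c x)"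
          by (auto simp: B'_def)
        then show "translate g u \<in> complex_fun.span B'"
        proof cases
          case 1
          then show ?thesis using Suc.prems(3) mono complex_fun.span_base by blast
        next
          case 2
          have c: "translate g c \<in> complex_fun.span B"
            using Suc.prems(3) 2(2) complex_fun.span_base by blast
          have "translate g u = (\<lambda>x. a b x * translate g c x) + fun_scaleC (a b g) (translate g c)"
            using 2 a[OF 2(1)] by (simp add: translate_def fun_eq_iff fun_scaleC_def
                scaleC_complex_def continuous_additive_def algebra_simps)
          moreover have "fun_scaleC (a b g) (translate g c) \<in> complex_fun.span B'"
            using c mono complex_fun.span_scale by blast
          ultimately show ?thesis
            using prod[OF 2(1) c] complex_fun.span_add by metis
        qed
      qed
      have "E = (\<Sum>b\<in>I. (\<lambda>x. a b x * b x))" by (simp add: E_def fun_eq_iff sum_fun_eval)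
      also have "\<dots> \<in> complex_fun.span B'"
        using I(2) by (intro complex_fun.span_sum prod) auto
      finally have "E \<in> complex_fun.span B'" .
      moreover have "fun_scaleC (of_nat m) f \<in> complex_fun.span B'"
        using Suc.prems(4) mono complex_fun.span_scale by blast
      ultimately have "E - fun_scaleC (of_nat m) f \<in> complex_fun.span B'"
        by (rule complex_fun.span_diff)
      moreover have "E - fun_scaleC (of_nat m) f = r"
        by (simp add: r_def fun_eq_iff fun_scaleC_def scaleC_complex_def)
      ultimately show "r \<in> complex_fun.span B'" by (simp only:)
      show "degree_below m r" by (fact r)
    qed
    then have "is_complex_polynomial (\<lambda>x. (1 / of_nat m) * (E x + (- 1) * r x))"
      by (intro is_complex_polynomial_add_mult is_complex_polynomial_const E)
    moreover have "(1 / of_nat m) * (E x + (- 1) * r x) = f x" for x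
      using False by (simp add: r_def)
    ultimately show ?thesis by simp
  qed
qed

lemma restrict_zero_UNIV: "restrict_zero UNIV f = f"
  by (simp add: restrict_zero_def)

text \<open>
  Composition with \<open>u\<close> is linear and commutes with translation, so it maps the finite-dimensional
  invariant space spanned by the translates of \<open>f\<close> onto a space of the same kind.
\<close>

lemma is_polynomial_imp_is_w_polynomial:
  fixes f :: "'g::topological_comm_monoid_add \<Rightarrow> 'e::complex_normed_vector"
  assumes "is_polynomial f"
  shows "is_w_polynomial f"
proof -
  let ?T = "range (\<lambda>g. translate g f)"
  have cont: "continuous_on UNIV f"
    using assms by (simp add: is_polynomial_on_def is_generalized_polynomial_on_def)
  obtain n where n: "degree_below n f"
    using assms by (auto simp: is_polynomial_on_def is_generalized_polynomial_on_def degree_below_iff_foldr)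
  obtain B where B: "finite B" "complex_fun.span B = complex_fun.span ?T"
    using assms by (auto simp: is_polynomial_on_def finite_dimensional_def translates_span_on_def
        restrict_zero_UNIV)
  have contT: "continuous_on UNIV v" if "v \<in> ?T" for v
    using that by (auto simp: translate_def intro!: continuous_on_compose2[OF cont] continuous_intros)
  have "is_complex_polynomial (u \<circ> f)" if "u \<in> dual_space" for u
  proof -
    have lin: "u (x + y) = u x + u y" "u (c *\<^sub>C x) = c * u x" and u: "continuous_on UNIV u" for x y c
      using that by (auto simp: dual_space_def Vector_Spaces.linear_iff)
    interpret U: Vector_Spaces.linear fun_scaleC fun_scaleC "\<lambda>v::'g \<Rightarrow> 'e. u \<circ> v"
      by unfold_locales (auto simp: fun_eq_iff fun_scaleC_def scaleC_complex_def lin)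
    let ?C = "(\<lambda>v. u \<circ> v) ` B"
    have span: "complex_fun.span ?C = (\<lambda>v. u \<circ> v) ` complex_fun.span ?T"
      by (simp add: U.span_image B(2))
    show ?thesis
    proof (rule is_complex_polynomial_if_degree_below[of ?C])
      show "finite ?C" using B(1) by simp
      show "continuous_on UNIV b" if "b \<in> ?C" for b
      proof -
        obtain v where v: "b = u \<circ> v" "v \<in> B" using \<open>b \<in> ?C\<close> by blast
        then have "v \<in> complex_fun.span ?T" using B(2) complex_fun.span_base by blast
        then have "continuous_on UNIV v" using contT continuous_on_complex_fun_span by blast
        then show ?thesis unfolding v(1) by (intro continuous_on_compose) (auto intro: continuous_on_subset[OF u])
      qed
      show "translate g v \<in> complex_fun.span ?C" if "v \<in> complex_fun.span ?C" for g v
      proof -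
        obtain w where w: "v = u \<circ> w" "w \<in> complex_fun.span ?T" using \<open>v \<in> _\<close> unfolding span by blast
        have "translate g w \<in> complex_fun.span ?T"
        proof (rule complex_fun_span_map[OF translate_linear _ w(2)])
          fix b assume "b \<in> ?T"
          then obtain h where "b = translate h f" by blast
          then have "translate g b = translate (g + h) f"
            by (simp add: translate_def fun_eq_iff add.assoc)
          then show "translate g b \<in> complex_fun.span ?T" by (simp add: complex_fun.span_base)
        qed
        moreover have "translate g v = u \<circ> translate g w"
          by (simp add: w(1) translate_def fun_eq_iff)
        ultimately show ?thesis using span by blast
      qed
      have "f = translate 0 f" by (simp add: translate_def)
      then have "f \<in> complex_fun.span ?T" by (metis complex_fun.span_base rangeI)
      then show "u \<circ> f \<in> complex_fun.span ?C" using span by blast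
      have "u (x - y) = u x - u y" for x y
        using lin(1)[of "x - y" y] by simp
      then show "degree_below n (u \<circ> f)"
        unfolding comp_def using degree_below_additive_image n by blast
    qed
  qed
  then show ?thesis using cont by (simp add: is_w_polynomial_def)
qed

section \<open>From generalized polynomials to local polynomials\<close>

lemma finite_dimensional_subspace:
  assumes "complex_fun.subspace V" "V \<subseteq> complex_fun.span F" "finite F"
  shows "finite_dimensional V"
proof -
  obtain B where B: "B \<subseteq> V" "complex_fun.independent B" "V \<subseteq> complex_fun.span B"
    using complex_fun.maximal_independent_subset by blast
  have "finite B"
    using complex_fun.independent_span_bound[OF assms(3) B(2)] B(1) assms(2) by blast
  moreover have "complex_fun.span B = V"
    using B(1,3) assms(1) by (rule complex_fun.span_subspace)
  ultimately show ?thesis unfolding finite_dimensional_def by blast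
qed

text \<open>
  The elements \<open>g\<close> whose translation preserves the span form a subsemigroup. It contains \<open>A\<close>
  since \<open>T\<^sub>h = 1 + \<Delta>\<^sub>h\<close> and a difference of order \<open>n + 1\<close> vanishes.
\<close>

lemma translates_in_span_of_differences:
  fixes f :: "'g::comm_monoid_add \<Rightarrow> 'e::complex_normed_vector"
  assumes f: "degree_below (Suc n) f" and g: "g \<in> subsemigroup_generated A"
  shows "translate g f \<in> complex_fun.span ((\<lambda>hs. foldr difference hs f) ` {hs. set hs \<subseteq> A \<and> length hs \<le> n})"
    (is "_ \<in> complex_fun.span ?F")
proof -
  let ?S = "{g. \<forall>v \<in> complex_fun.span ?F. translate g v \<in> complex_fun.span ?F}"
  have "A \<subseteq> ?S"
  proof safe
    fix h v assume h: "h \<in> A" and v: "v \<in> complex_fun.span ?F"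
    show "translate h v \<in> complex_fun.span ?F"
    proof (rule complex_fun_span_map[OF translate_linear _ v])
      fix b assume b: "b \<in> ?F"
      then obtain hs where hs: "b = foldr difference hs f" "set hs \<subseteq> A" "length hs \<le> n" by blast
      have "difference h b \<in> complex_fun.span ?F"
      proof (cases "length hs = n")
        case True
        then have "difference h b = 0"
          using f[unfolded degree_below_iff_foldr, rule_format, of "h # hs"]
          by (simp add: hs(1) fun_eq_iff)
        then show ?thesis using complex_fun.span_zero by metis
      next
        case False
        then have "difference h b \<in> ?F"
          using hs h by (intro image_eqI[of _ _ "h # hs"]) auto
        then show ?thesis by (rule complex_fun.span_base)
      qed
      then have "b + difference h b \<in> complex_fun.span ?F"
        using complex_fun.span_add[OF complex_fun.span_base[OF b]] by blast
      moreover have "b + difference h b = translate h b"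
        by (simp add: translate_def difference_def fun_eq_iff)
      ultimately show "translate h b \<in> complex_fun.span ?F" by (simp only:)
    qed
  qed
  moreover have "\<forall>x\<in>?S. \<forall>y\<in>?S. x + y \<in> ?S"
  proof -
    have "translate (x + y) v = translate x (translate y v)" for x y and v :: "'g \<Rightarrow> 'e"
      by (simp add: translate_def fun_eq_iff add.assoc)
    then show ?thesis by simp
  qed
  ultimately have "subsemigroup_generated A \<subseteq> ?S"
    unfolding subsemigroup_generated_def by (rule hull_minimal)
  moreover have "f \<in> complex_fun.span ?F"
    by (intro complex_fun.span_base image_eqI[of _ _ "[]"]) auto
  ultimately show ?thesis using g by blast
qed

lemma is_generalized_polynomial_imp_is_local_polynomial:
  fixes f :: "'g::topological_comm_monoid_add \<Rightarrow> 'e::complex_normed_vector"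
  assumes "is_generalized_polynomial f"
  shows "is_local_polynomial f"
proof -
  obtain n where cont: "continuous_on UNIV f"
    and n: "\<And>hs x. length hs = n + 1 \<Longrightarrow> foldr difference hs f x = 0"
    using assms by (auto simp: is_generalized_polynomial_on_def)
  have deg: "degree_below (Suc n) f" using n by (simp add: degree_below_iff_foldr)
  have "is_polynomial_on (subsemigroup_generated A) f" if "finite A" for A
  proof -
    let ?S = "subsemigroup_generated A"
    let ?F = "(\<lambda>hs. foldr difference hs f) ` {hs. set hs \<subseteq> A \<and> length hs \<le> n}"
    have "finite ?F" using finite_lists_length_le[OF that] by blast
    have "restrict_zero ?S (translate g f) \<in> complex_fun.span (restrict_zero ?S ` ?F)"
      if "g \<in> ?S" for g
      by (rule complex_fun_span_map[OF _ _ _ translates_in_span_of_differences[OF deg that]])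
        (auto simp: restrict_zero_def fun_scaleC_def fun_eq_iff intro: complex_fun.span_base)
    then have "translates_span_on ?S f \<subseteq> complex_fun.span (restrict_zero ?S ` ?F)"
      unfolding translates_span_on_def
      by (intro complex_fun.span_minimal complex_fun.subspace_span) blast
    then have "finite_dimensional (translates_span_on ?S f)"
      using finite_dimensional_subspace[OF _ _ finite_imageI[OF \<open>finite ?F\<close>]]
      unfolding translates_span_on_def by blast
    moreover have "is_generalized_polynomial_on ?S f"
      unfolding is_generalized_polynomial_on_def
      using n continuous_on_subset[OF cont] by blast
    ultimately show ?thesis by (simp add: is_polynomial_on_def)
  qed
  then show ?thesis using cont by (simp add: is_local_polynomial_def)
qed

section \<open>Extension of functionals\<close>

text \<open>
  Homogeneity is only required as an inequality, which is easier to establish; equality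
  follows by scaling back with \<open>1 / c\<close>.
\<close>

definition sublinear :: "('a::real_vector \<Rightarrow> real) \<Rightarrow> bool"
  where "sublinear p \<longleftrightarrow> (\<forall>x y. p (x + y) \<le> p x + p y) \<and> (\<forall>c x. 0 \<le> c \<longrightarrow> p (c *\<^sub>R x) \<le> c * p x)"

lemma sublinear_add: "sublinear p \<Longrightarrow> p (x + y) \<le> p x + p y"
  by (simp add: sublinear_def)

lemma sublinear_zero: "sublinear p \<Longrightarrow> p 0 = 0"
  using sublinear_add[of p 0 0] unfolding sublinear_def
  by (metis add_cancel_left_left dual_order.eq_iff le_add_same_cancel1 mult_zero_left order_refl scaleR_zero_left)

lemma sublinear_neg: "sublinear p \<Longrightarrow> - p (- x) \<le> p x"
  using sublinear_add[of p x "- x"] sublinear_zero[of p] by simp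

lemma sublinear_scale:
  assumes "sublinear p" "0 \<le> c"
  shows "p (c *\<^sub>R x) = c * p x"
proof (cases "c = 0")
  case False
  have "p ((1 / c) *\<^sub>R (c *\<^sub>R x)) \<le> (1 / c) * p (c *\<^sub>R x)"
    using assms unfolding sublinear_def by (metis zero_le_divide_1_iff)
  then have "c * p x \<le> p (c *\<^sub>R x)"
    using False assms(2) by (simp add: field_simps)
  then show ?thesis using assms unfolding sublinear_def by (meson order_antisym)
qed (use assms sublinear_zero in auto)

text \<open>
  The functional \<open>q x = inf\<^bsub>t \<ge> 0\<^esub> (p (x + t y) - t p y)\<close> is the largest sublinear one below \<open>p\<close> whose value at
  \<open>- y\<close> is at most \<open>- p y\<close>. It is used twice: to show that a minimal sublinear functional is
  linear, and to force the value at a given vector.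
\<close>

lemma sublinear_reduce:
  assumes p: "sublinear p"
  obtains q where "sublinear q" "\<And>x. q x \<le> p x" "q (- y) \<le> - p y"
proof -
  define b where "b x t = p (x + t *\<^sub>R y) - t * p y" for x t
  define q where "q x = (INF t\<in>{0..}. b x t)" for x
  have "- p (- x) \<le> b x t" if "0 \<le> t" for x t
    using sublinear_add[OF p, of "x + t *\<^sub>R y" "- x"] sublinear_scale[OF p that, of y]
    by (simp add: b_def)
  then have bdd: "bdd_below (b x ` {0..})" for x by (intro bdd_belowI2) auto
  have lower: "q x \<le> b x t" if "0 \<le> t" for x t
    unfolding q_def by (rule cINF_lower[OF bdd]) (use that in simp)
  have greatest: "c \<le> q x" if "\<And>t. 0 \<le> t \<Longrightarrow> c \<le> b x t" for c x
    unfolding q_def by (rule cINF_greatest) (use that in auto)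
  have "q (x + z) \<le> q x + q z" for x z
  proof -
    have "q (x + z) \<le> b x s + b z t" if "0 \<le> s" "0 \<le> t" for s t
    proof -
      have "b (x + z) (s + t) \<le> b x s + b z t"
        using sublinear_add[OF p, of "x + s *\<^sub>R y" "z + t *\<^sub>R y"] by (simp add: b_def algebra_simps)
      then show ?thesis using lower[of "s + t" "x + z"] that by linarith
    qed
    then have "q (x + z) - b z t \<le> q x" if "0 \<le> t" for t
      using that by (intro greatest) (simp add: diff_le_eq)
    then have "q (x + z) - q x \<le> q z"
      by (intro greatest) (simp add: algebra_simps)
    then show ?thesis by simp
  qed
  moreover have "q (c *\<^sub>R x) \<le> c * q x" if "0 \<le> c" for c x
  proof (cases "c = 0")
    case True
    then show ?thesis using lower[of 0 0] by (simp add: b_def sublinear_zero[OF p])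
  next
    case False
    have "q (c *\<^sub>R x) / c \<le> b x t" if "0 \<le> t" for t
    proof -
      have "b (c *\<^sub>R x) (c * t) = c * b x t"
        using sublinear_scale[OF p \<open>0 \<le> c\<close>, of "x + t *\<^sub>R y"] by (simp add: b_def algebra_simps)
      then show ?thesis
        using lower[of "c * t" "c *\<^sub>R x"] that \<open>0 \<le> c\<close> False by (simp add: field_simps)
    qed
    then have "q (c *\<^sub>R x) / c \<le> q x" by (rule greatest)
    then show ?thesis using \<open>0 \<le> c\<close> False by (simp add: field_simps)
  qed
  ultimately have "sublinear q" by (simp add: sublinear_def)
  moreover have "q x \<le> p x" for x using lower[of 0 x] by (simp add: b_def)
  moreover have "q (- y) \<le> - p y"
    using lower[of 1 "- y"] by (simp add: b_def sublinear_zero[OF p])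
  ultimately show ?thesis using that by blast
qed

text \<open>
  By Zorn's lemma there is a minimal sublinear functional \<open>m\<close> below \<open>p\<close>. Reducing \<open>m\<close> at any \<open>y\<close> cannot make it
  smaller, so \<open>m (- y) \<le> - m y\<close>, and an odd sublinear functional is linear.
\<close>

lemma linear_below_sublinear:
  assumes p: "sublinear p"
  obtains m where "linear m" "\<And>x. m x \<le> p x"
proof -
  define A where "A = {q. sublinear q \<and> q \<le> p}"
  \<comment> \<open>Zorn's lemma for the reversed order: a chain is bounded by its pointwise infimum.\<close>
  have "\<exists>m\<in>A. \<forall>q\<in>A. q \<le> m \<longrightarrow> q = m"
  proof (rule predicate_Zorn[of A "\<lambda>q r. r \<le> q"])
    show "partial_order_on A (relation_of (\<lambda>q r. r \<le> q) A)"
      by (rule partial_order_on_relation_ofI) auto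
    fix C assume C: "C \<in> Chains (relation_of (\<lambda>q r. r \<le> q) A)"
    then have CA: "C \<subseteq> A" and total: "\<And>q r. q \<in> C \<Longrightarrow> r \<in> C \<Longrightarrow> q \<le> r \<or> r \<le> q"
      by (auto simp: Chains_def relation_of_def)
    show "\<exists>u\<in>A. \<forall>q\<in>C. u \<le> q"
    proof (cases "C = {}")
      case True
      then show ?thesis using p by (auto simp: A_def)
    next
      case False
      define u where "u x = (INF q\<in>C. q x)" for x
      have "- p (- x) \<le> q x" if "q \<in> C" for q x
      proof -
        have "sublinear q" "q (- x) \<le> p (- x)" using CA that by (auto simp: A_def le_fun_def)
        then show ?thesis using sublinear_neg[of q x] by linarith
      qed
      then have lower: "u x \<le> q x" if "q \<in> C" for q x
        unfolding u_def by (intro cINF_lower that bdd_belowI2)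
      have greatest: "c \<le> u x" if "\<And>q. q \<in> C \<Longrightarrow> c \<le> q x" for c x
        unfolding u_def by (rule cINF_greatest[OF False that])
      have "u (x + y) \<le> u x + u y" for x y
      proof -
        have *: "u (x + y) \<le> q x + r y" if "q \<in> C" "r \<in> C" for q r
        proof -
          obtain s where s: "s \<in> C" "s \<le> q" "s \<le> r"
            using total[of q r] \<open>q \<in> C\<close> \<open>r \<in> C\<close> by blast
          have "sublinear s" using CA s(1) by (auto simp: A_def)
          then have "u (x + y) \<le> s x + s y"
            using lower[OF s(1), of "x + y"] sublinear_add[of s x y] by linarith
          moreover have "s x \<le> q x" "s y \<le> r y" using s(2,3) by (simp_all add: le_fun_def)
          ultimately show ?thesis by linarith
        qed
        then have "u (x + y) - r y \<le> u x" if "r \<in> C" for r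
          using that by (intro greatest) (simp add: diff_le_eq)
        then have "u (x + y) - u x \<le> u y"
          by (intro greatest) (simp add: algebra_simps)
        then show ?thesis by simp
      qed
      moreover have "u (c *\<^sub>R x) \<le> c * u x" if "0 \<le> c" for c x
      proof (cases "c = 0")
        case True
        obtain q where "q \<in> C" using False by blast
        then show ?thesis
          using True lower[of q 0] sublinear_zero[of q] CA by (auto simp: A_def)
      next
        case cpos: False
        have "u (c *\<^sub>R x) / c \<le> q x" if "q \<in> C" for q
          using lower[OF that, of "c *\<^sub>R x"] sublinear_scale[of q c x] that CA \<open>0 \<le> c\<close> cpos
          by (auto simp: A_def field_simps)
        then have "u (c *\<^sub>R x) / c \<le> u x" by (rule greatest)
        then show ?thesis using \<open>0 \<le> c\<close> cpos by (simp add: field_simps)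
      qed
      ultimately have "sublinear u" by (simp add: sublinear_def)
      moreover have "u \<le> p"
      proof -
        obtain q where "q \<in> C" using False by blast
        then have "u \<le> q" "q \<le> p" using lower CA by (auto simp: A_def le_fun_def)
        then show ?thesis by (rule order_trans)
      qed
      ultimately show ?thesis using lower by (auto simp: A_def le_fun_def)
    qed
  qed
  then obtain m where m: "sublinear m" "m \<le> p"
    and minimal: "\<And>q. sublinear q \<Longrightarrow> q \<le> m \<Longrightarrow> q = m"
    unfolding A_def by (blast intro: order_trans)
  have neg: "m (- y) = - m y" for y
  proof -
    obtain q where q: "sublinear q" "\<And>x. q x \<le> m x" "q (- y) \<le> - m y"
      using sublinear_reduce[OF m(1)] by blast
    have "q = m" using q(1,2) by (intro minimal) (auto simp: le_fun_def)
    then show ?thesis using q(3) sublinear_neg[OF m(1), of y] by auto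
  qed
  have "linear m"
  proof (rule linearI)
    fix x y
    have "m x \<le> m (x + y) + m (- y)"
      using sublinear_add[OF m(1), of "x + y" "- y"] by simp
    then show "m (x + y) = m x + m y"
      using sublinear_add[OF m(1), of x y] neg by simp
  next
    fix c x
    show "m (c *\<^sub>R x) = c *\<^sub>R m x"
    proof (cases "0 \<le> c")
      case True
      then show ?thesis using sublinear_scale[OF m(1)] by simp
    next
      case False
      then have "m ((- c) *\<^sub>R x) = (- c) * m x" using sublinear_scale[OF m(1), of "- c"] by simp
      then show ?thesis using neg[of "c *\<^sub>R x"] by simp
    qed
  qed
  then show ?thesis using that m(2) by (auto simp: le_fun_def)
qed

text \<open>
  The norm is first reduced at \<open>v\<close>, so that every linear functional below the result is at most
  \<open>- norm v\<close> at \<open>- v\<close>.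
\<close>

lemma norming_functional:
  fixes v :: "'a::real_normed_vector"
  obtains r :: "'a \<Rightarrow>\<^sub>L real" where "norm v \<le> r v"
proof -
  have "sublinear (norm :: 'a \<Rightarrow> real)"
    by (simp add: sublinear_def norm_triangle_ineq)
  then obtain q where q: "sublinear q" "\<And>x. q x \<le> norm x" "q (- v) \<le> - norm v"
    using sublinear_reduce by blast
  obtain m where m: "linear m" "\<And>x. m x \<le> q x"
    using linear_below_sublinear[OF q(1)] by blast
  have le: "m x \<le> norm x" for x using m(2) q(2) order_trans by blast
  have neg: "m (- x) = - m x" for x using m(1) by (rule linear_neg)
  have "\<bar>m x\<bar> \<le> norm x" for x
    using le[of x] le[of "- x"] neg[of x] by simp
  then have "bounded_linear m"
    using m(1) by (intro bounded_linear_intro[of m 1]) (auto simp: linear_add linear_scale)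
  moreover have "norm v \<le> m v"
    using m(2)[of "- v"] q(3) neg[of v] by linarith
  ultimately show ?thesis using that[of "Blinfun m"] by (simp add: bounded_linear_Blinfun_apply)
qed

section \<open>From w-polynomials to generalized polynomials\<close>

text \<open>
  By Baire's theorem some \<open>D n\<close> has an interior point, and a subspace containing a ball is everything.
\<close>

lemma banach_union_of_closed_subspaces:
  fixes D :: "nat \<Rightarrow> 'a::banach set"
  assumes closed: "\<And>n. closed (D n)" and subspace: "\<And>n. subspace (D n)" and "(\<Union>n. D n) = UNIV"
  shows "\<exists>n. D n = UNIV"
proof (rule ccontr)
  assume proper: "\<nexists>n. D n = UNIV"
  have "interior (D n) = {}" for n
  proof (rule ccontr)
    assume "interior (D n) \<noteq> {}"
    then obtain x e where x: "0 < e" "cball x e \<subseteq> D n"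
      by (metis all_not_in_conv mem_interior_cball)
    have "y \<in> D n" for y
    proof (cases "y = 0")
      case True
      then show ?thesis using subspace subspace_0 by blast
    next
      case False
      let ?c = "e / norm y"
      have "x + ?c *\<^sub>R y \<in> D n" "x \<in> D n"
        using x False by (auto simp: dist_norm subset_iff)
      then have "(1 / ?c) *\<^sub>R ((x + ?c *\<^sub>R y) - x) \<in> D n"
        using subspace by (intro subspace_scale subspace_diff)
      then show ?thesis using x(1) False by simp
    qed
    then show False using proper by blast
  qed
  then have "Met_TC.mtopology interior_of \<Union>(range D) = {}"
    using closed
    by (intro Met_TC.metric_Baire_category_alt) (auto simp: complete_UNIV)
  then show False using assms(3) by simp
qed

text \<open>
  The argument runs in the real dual of \<open>'e\<close>; a real functional \<open>r\<close> enters the hypothesis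
  through the complex functional \<open>v \<mapsto> r v - \<i> r (\<i> v)\<close>, whose real part it is.
\<close>

lemma is_w_polynomial_imp_is_generalized_polynomial:
  fixes f :: "'g::topological_comm_monoid_add \<Rightarrow> 'e::complex_banach"
  assumes "is_w_polynomial f"
  shows "is_generalized_polynomial f"
proof -
  have cont: "continuous_on UNIV f" using assms by (simp add: is_w_polynomial_def)
  define D :: "nat \<Rightarrow> ('e \<Rightarrow>\<^sub>L real) set"
    where "D n = {r. \<forall>hs x. length hs = n \<longrightarrow> blinfun_apply r (foldr difference hs f x) = 0}" for n
  have "closed (D n)" for n
  proof -
    have "closed {r :: 'e \<Rightarrow>\<^sub>L real. blinfun_apply r v = 0}" for v
      by (intro closed_Collect_eq continuous_intros)
    moreover have "D n = (\<Inter>hs\<in>{hs. length hs = n}. \<Inter>x. {r. blinfun_apply r (foldr difference hs f x) = 0})"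
      by (auto simp: D_def)
    ultimately show ?thesis by (simp add: closed_INT)
  qed
  moreover have "subspace (D n)" for n
    by (auto simp: D_def subspace_def blinfun.bilinear_simps)
  moreover have "\<exists>n. r \<in> D n" for r
  proof -
    define u where "u v = Complex (r v) (- r (\<i> *\<^sub>C v))" for v
    have add: "u (v + w) = u v + u w" for v w
      by (simp add: u_def complex_eq_iff blinfun.add_right scaleC_add_right)
    have scale: "u (c *\<^sub>C v) = c * u v" for c v
    proof -
      have real: "r (complex_of_real t *\<^sub>C w) = t * r w" for t w
        by (simp add: scaleC_of_real blinfun.scaleR_right)
      have c: "r (c *\<^sub>C w) = Re c * r w + Im c * r (\<i> *\<^sub>C w)" for c w
      proof -
        have "c *\<^sub>C w = complex_of_real (Re c) *\<^sub>C w + complex_of_real (Im c) *\<^sub>C \<i> *\<^sub>C w"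
          by (simp add: scaleC_scaleC flip: scaleC_add_left) (simp add: complex_eq mult.commute)
        then show ?thesis by (simp only: blinfun.add_right real)
      qed
      have "r (\<i> *\<^sub>C c *\<^sub>C v) = Re c * r (\<i> *\<^sub>C v) - Im c * r v"
        using c[of "\<i> * c" v] by (simp add: scaleC_scaleC)
      then show ?thesis by (simp add: u_def complex_eq_iff c[of c v] algebra_simps)
    qed
    have "continuous_on UNIV u"
    proof -
      have i: "continuous_on UNIV (\<lambda>v::'e. \<i> *\<^sub>C v)"
        by (intro linear_continuous_on bounded_linear_intro[of _ 1])
          (simp_all add: scaleC_add_right norm_scaleC scaleC_scaleC mult.commute flip: scaleC_of_real)
      show ?thesis
        unfolding u_def Complex_eq by (intro continuous_intros i)
    qed
    moreover have "Vector_Spaces.linear (*\<^sub>C) (*) u"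
      by unfold_locales (simp_all add: add scale algebra_simps)
    ultimately have "u \<in> dual_space" by (simp add: dual_space_def)
    then obtain n where "degree_below n (\<lambda>x. u (f x))"
      using assms is_complex_polynomial_imp_degree_below
      by (fastforce simp: is_w_polynomial_def comp_def)
    moreover have "foldr difference hs (\<lambda>x. u (f x)) x = u (foldr difference hs f x)" for hs x
    proof (induction hs arbitrary: x)
      case (Cons h hs)
      have "u (v - w) = u v - u w" for v w using add[of "v - w" w] by simp
      then show ?case using Cons by (simp add: difference_def)
    qed simp
    ultimately have "r \<in> D n"
      by (auto simp: degree_below_iff_foldr D_def u_def complex_eq_iff)
    then show ?thesis ..
  qed
  then have "(\<Union>n. D n) = UNIV" by auto
  ultimately have "\<exists>n. D n = UNIV" by (intro banach_union_of_closed_subspaces)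
  then obtain n where n: "D n = UNIV" ..
  have "foldr difference hs f x = 0" if "length hs = n" for hs x
  proof -
    obtain r :: "'e \<Rightarrow>\<^sub>L real" where "norm (foldr difference hs f x) \<le> r (foldr difference hs f x)"
      by (rule norming_functional)
    moreover have "r (foldr difference hs f x) = 0" using n that by (auto simp: D_def)
    ultimately show ?thesis by simp
  qed
  then have "degree_below n f" by (simp add: degree_below_iff_foldr)
  then have "degree_below (n + 1) f" by (metis degree_below_Suc Suc_eq_plus1)
  then show ?thesis
    using cont by (auto simp: is_generalized_polynomial_on_def degree_below_iff_foldr)
qed

theorem theorem8:
  fixes f :: "'g::topological_comm_monoid_add \<Rightarrow> 'e::complex_banach"
  assumes "continuous_on UNIV f"
  shows "(is_polynomial f \<longrightarrow> is_w_polynomial f) \<and>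
    (is_w_polynomial f \<longrightarrow> is_generalized_polynomial f) \<and>
    (is_generalized_polynomial f \<longrightarrow> is_local_polynomial f)"
  using is_polynomial_imp_is_w_polynomial is_w_polynomial_imp_is_generalized_polynomial
    is_generalized_polynomial_imp_is_local_polynomial
  by blast

end
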